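(* Let $\{F_\theta:\theta\in\Theta\}$ be a standard exponential family generated by $F_0$, with $\Theta=[0,\theta_{\max})$, and for $\theta\in\Theta$ let $X_1,X_2,\dots$ be i.i.d. with law $F_\theta$ under $\mathbb{P}_\theta$. Then there exists $\theta^\ast>0$ with $[0,\theta^\ast]\subset\Theta$ such that for every $k\in\mathbb{N}$ ($k\ge1$) there exists $\theta_k\in(0,\theta^\ast]$ such that for all $\theta\in(0,\theta_k]$ and all $b\ge0$, $$\mathbb{E}_\theta[R_b^{\,k}]\ \le\ \frac{\mathbb{E}_\theta[(X_1^+)^{k+1}]}{\mu_\theta}.$$
   Context: Standard exponential family: $F_0$ is a probability measure on $\mathbb{R}$ and $\Theta=[0,\theta_{\max})$, $\theta_{\max}\in(0,\infty]$, is such that $\int e^{\theta x}F_0(dx)<\infty$ for all $\theta\in\Theta$. Put $\psi(\theta)=\ln\int e^{\theta x}F_0(dx)$ and $F_\theta(dx)=e^{\theta x-\psi(\theta)}F_0(dx)$. The family $\{F_\theta\}$ is called standard if, for $X\sim F_0$, $\mathbb{E}[X]=0$ and $\mathrm{Var}(X)=1$, and $F_0$ is strongly non-lattice, i.e. $\limsup_{|t|\to\infty}\left|\int e^{itx}F_0(dx)\right|<1$. $\mathbb{P}_\theta,\mathbb{E}_\theta$ denote probability and expectation when $X_1,X_2,\dots$ are i.i.d. with law $F_\theta$; $\mu_\theta:=\mathbb{E}_\theta[X_1]=\psi'(\theta)$, which is $>0$ for $\theta>0$. $S_0=0$, $S_n=X_1+\dots+X_n$. For $b\ge 0$: $\tau(b)=\inf\{n\ge1:S_n>b\}$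 and the overshoot is $R_b=S_{\tau(b)}-b$. $x^+=\max\{x,0\}$. *)

theory Defs
  imports "HOL-Probability.Probability"
begin

definition param_space :: "ereal \<Rightarrow> real set" where
  "param_space \<theta>max = {\<theta>. 0 \<le> \<theta> \<and> ereal \<theta> < \<theta>max}"

definition cumulant :: "real measure \<Rightarrow> real \<Rightarrow> real" where
  "cumulant F0 \<theta> = ln (\<integral>x. exp (\<theta> * x) \<partial>F0)"

definition tilted :: "real measure \<Rightarrow> real \<Rightarrow> real measure" where
  "tilted F0 \<theta> = density F0 (\<lambda>x. ennreal (exp (\<theta> * x - cumulant F0 \<theta>)))"

(* On the real line at_infinity is the filter of neighbourhoods |t| -> infinity. *)
definition strongly_nonlattice :: "real measure \<Rightarrow> bool" where
  "strongly_nonlattice F \<longleftrightarrow> Limsup at_infinity (\<lambda>t. ereal (cmod (char F t))) < 1"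

(* The integrability of x and x^2 is spelled out because Bochner integrals of
   non-integrable functions are 0 by convention. *)
locale standard_exponential_family = real_distribution F0 for F0 :: "real measure" +
  fixes \<theta>max :: ereal
  assumes \<theta>max_pos: "0 < \<theta>max"
    and exp_integrable: "\<And>\<theta>. \<theta> \<in> param_space \<theta>max \<Longrightarrow> integrable F0 (\<lambda>x. exp (\<theta> * x))"
    and mean_integrable: "integrable F0 (\<lambda>x. x)"
    and mean_zero: "expectation (\<lambda>x. x) = 0"
    and square_integrable: "integrable F0 (\<lambda>x. x\<^sup>2)"
    and variance_one: "variance (\<lambda>x. x) = 1"
    and nonlattice: "strongly_nonlattice F0"

(* The sequence is X 1, X 2, ...; the entry X 0 plays no role. *)
definition iid_sequence :: "'a measure \<Rightarrow> (nat \<Rightarrow> 'a \<Rightarrow> real) \<Rightarrow> real measure \<Rightarrow> bool" where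
  "iid_sequence P X F \<longleftrightarrow>
     prob_space P \<and>
     prob_space.indep_vars P (\<lambda>_. borel) X {1..} \<and>
     (\<forall>i\<ge>1. distr P borel (X i) = F)"

definition walk :: "(nat \<Rightarrow> 'a \<Rightarrow> real) \<Rightarrow> nat \<Rightarrow> 'a \<Rightarrow> real" where
  "walk X n \<omega> = (\<Sum>i=1..n. X i \<omega>)"

definition passage_time :: "(nat \<Rightarrow> 'a \<Rightarrow> real) \<Rightarrow> real \<Rightarrow> 'a \<Rightarrow> enat" where
  "passage_time X b \<omega> = Inf (enat ` {n. 1 \<le> n \<and> walk X n \<omega> > b})"

(* The overshoot is positive when the passage time is finite, so embedding it into
   ennreal loses nothing.  On the event that b is never exceeded (a null event for
   positive drift) it is set to infinity, so that this event cannot make a moment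
   of the overshoot smaller. *)
definition overshoot :: "(nat \<Rightarrow> 'a \<Rightarrow> real) \<Rightarrow> real \<Rightarrow> 'a \<Rightarrow> ennreal" where
  "overshoot X b \<omega> =
     (case passage_time X b \<omega> of enat n \<Rightarrow> ennreal (walk X n \<omega> - b) | \<infinity> \<Rightarrow> \<infinity>)"

end

theory Submission
  imports Defs
begin

text \<open>
  As \<open>\<theta>\<close> tends to 0 the mean \<open>\<mu>\<close> of the tilted law tends to 0, whereas the moment of the positive part
  in the numerator stays bounded below; so the right-hand side tends to infinity, and it suffices to
  bound the moments of the overshoot uniformly in \<open>b\<close> and small \<open>\<theta>\<close>. Such a bound comes from a
  nonnegative function \<open>W\<close> of the distance to the barrier that is superharmonic for the walk below the
  barrier, dominates \<open>y ^ k\<close> above it and is bounded below it, uniformly in \<open>\<theta>\<close>. The barrier is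
  crossed almost surely by the Chernoff bound with exponent \<open>\<theta>\<close>, because
  \<open>E\<^sub>\<theta>[exp (- \<theta> X)] = exp (- \<psi>(\<theta>)) < 1\<close>.
\<close>

section \<open>The walk, its first passage time and the events of not having crossed yet\<close>

lemma iid_sequenceD:
  assumes "iid_sequence P X F"
  shows "prob_space P"
    and "prob_space.indep_vars P (\<lambda>_. borel) X {1..}"
    and "1 \<le> i \<Longrightarrow> distr P borel (X i) = F"
    and "1 \<le> i \<Longrightarrow> X i \<in> borel_measurable P"
proof -
  show P: "prob_space P" and ind: "prob_space.indep_vars P (\<lambda>_. borel) X {1..}"
    using assms by (auto simp: iid_sequence_def)
  show "1 \<le> i \<Longrightarrow> distr P borel (X i) = F"
    using assms by (simp add: iid_sequence_def)
  show "1 \<le> i \<Longrightarrow> X i \<in> borel_measurable P"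
    using ind by (auto simp: prob_space.indep_vars_def[OF P])
qed

lemma walk_measurable:
  assumes "iid_sequence P X F"
  shows "walk X n \<in> borel_measurable P"
  unfolding walk_def using iid_sequenceD(4)[OF assms]
  by (intro borel_measurable_sum) auto

text \<open>This is the event that the passage time exceeds \<open>n\<close>. Time 0 is not tested,
  so for \<open>n = 0\<close> it is the whole space whatever \<open>b\<close> is.\<close>

definition below :: "'a measure \<Rightarrow> (nat \<Rightarrow> 'a \<Rightarrow> real) \<Rightarrow> real \<Rightarrow> nat \<Rightarrow> 'a set" where
  "below P X b n = {\<omega> \<in> space P. \<forall>i\<in>{1..n}. walk X i \<omega> \<le> b}"

lemma below_sets:
  assumes "iid_sequence P X F"
  shows "below P X b n \<in> sets P"
  unfolding below_def using walk_measurable[OF assms] by measurable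

lemma below_Suc:
  "below P X b (Suc n) = {\<omega> \<in> below P X b n. walk X (Suc n) \<omega> \<le> b}"
  by (auto simp: below_def le_Suc_eq)

lemma Inf_enat_mem:
  fixes S :: "enat set"
  assumes "S \<noteq> {}"
  shows "Inf S \<in> S"
proof -
  obtain x where "x \<in> S" using assms by blast
  then have "(LEAST x. x \<in> S) \<in> S" by (rule LeastI)
  then show ?thesis using assms by (simp add: Inf_enat_def)
qed

lemma passage_time_eq_infinity_iff:
  "passage_time X b \<omega> = \<infinity> \<longleftrightarrow> (\<forall>n\<ge>1. walk X n \<omega> \<le> b)"
proof -
  let ?S = "{n. 1 \<le> n \<and> walk X n \<omega> > b}"
  have "Inf (enat ` ?S) = \<infinity> \<longleftrightarrow> ?S = {}"
  proof
    assume inf: "Inf (enat ` ?S) = \<infinity>"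
    show "?S = {}"
    proof (rule ccontr)
      assume "?S \<noteq> {}"
      then have "Inf (enat ` ?S) \<in> enat ` ?S" by (intro Inf_enat_mem) simp
      then show False unfolding inf by blast
    qed
  next
    assume "?S = {}"
    then show "Inf (enat ` ?S) = \<infinity>" by (simp only: image_empty) (simp add: Inf_enat_def)
  qed
  then show ?thesis
    unfolding passage_time_def by (simp add: not_less)
qed

lemma passage_time_enatD:
  assumes "passage_time X b \<omega> = enat n"
  shows "1 \<le> n" "b < walk X n \<omega>" "\<And>i. 1 \<le> i \<Longrightarrow> i < n \<Longrightarrow> walk X i \<omega> \<le> b"
proof -
  let ?S = "enat ` {n. 1 \<le> n \<and> walk X n \<omega> > b}"
  have "\<not> (\<forall>n\<ge>1. walk X n \<omega> \<le> b)"
    unfolding passage_time_eq_infinity_iff[symmetric] assms by simp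
  then have "?S \<noteq> {}" by (auto simp only: not_le)
  then have "Inf ?S \<in> ?S" by (rule Inf_enat_mem)
  then show "1 \<le> n" "b < walk X n \<omega>"
    using assms by (auto simp: passage_time_def)
  show "walk X i \<omega> \<le> b" if "1 \<le> i" "i < n" for i
  proof (rule ccontr)
    assume "\<not> walk X i \<omega> \<le> b"
    then have "Inf ?S \<le> enat i"
      using that by (intro Inf_lower) auto
    then show False
      using assms that by (simp add: passage_time_def)
  qed
qed

section \<open>Superharmonic functions along the walk, overshoot moments and almost sure
  passage\<close>

text \<open>By independence the joint law is a product, so the increment \<open>Y\<close> can be
  integrated out first with \<open>Z\<close> frozen; \<open>step\<close> then applies pointwise.
  This replaces conditional expectations.\<close>

lemma nn_integral_indep_step:
  fixes Z Y :: "'a \<Rightarrow> real" and W :: "real \<Rightarrow> ennreal"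
  assumes P: "prob_space P" and ind: "prob_space.indep_var P borel Z borel Y"
    and [measurable]: "W \<in> borel_measurable borel"
    and step: "\<And>y. y \<le> 0 \<Longrightarrow> (\<integral>\<^sup>+x. W (y + x) \<partial>distr P borel Y) \<le> W y"
  shows "(\<integral>\<^sup>+\<omega>. (if Z \<omega> \<le> 0 then W (Z \<omega> + Y \<omega>) else 0) \<partial>P)
    \<le> (\<integral>\<^sup>+\<omega>. (if Z \<omega> \<le> 0 then W (Z \<omega>) else 0) \<partial>P)"
proof -
  interpret prob_space P by fact
  have eq: "distr P borel Z \<Otimes>\<^sub>M distr P borel Y = distr P (borel \<Otimes>\<^sub>M borel) (\<lambda>\<omega>. (Z \<omega>, Y \<omega>))"
    and [measurable]: "Z \<in> borel_measurable P" "Y \<in> borel_measurable P"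
    using ind unfolding indep_var_distribution_eq by auto
  interpret Y: prob_space "distr P borel Y" by (rule prob_space_distr) simp
  define h where "h = (\<lambda>(z, y). if z \<le> 0 then W (z + y) else 0 :: ennreal)"
  have h [measurable]: "h \<in> borel_measurable (borel \<Otimes>\<^sub>M borel)"
    unfolding h_def by measurable
  have "(\<integral>\<^sup>+\<omega>. (if Z \<omega> \<le> 0 then W (Z \<omega> + Y \<omega>) else 0) \<partial>P) = (\<integral>\<^sup>+\<omega>. h (Z \<omega>, Y \<omega>) \<partial>P)"
    by (simp add: h_def)
  also have "\<dots> = (\<integral>\<^sup>+p. h p \<partial>distr P (borel \<Otimes>\<^sub>M borel) (\<lambda>\<omega>. (Z \<omega>, Y \<omega>)))"
    by (subst nn_integral_distr) simp_all
  also have "\<dots> = (\<integral>\<^sup>+z. \<integral>\<^sup>+y. h (z, y) \<partial>distr P borel Y \<partial>distr P borel Z)"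
    unfolding eq[symmetric] by (subst Y.nn_integral_fst[symmetric]) simp_all
  also have "\<dots> \<le> (\<integral>\<^sup>+z. (if z \<le> 0 then W z else 0) \<partial>distr P borel Z)"
    by (intro nn_integral_mono) (auto simp: h_def step)
  also have "\<dots> = (\<integral>\<^sup>+\<omega>. (if Z \<omega> \<le> 0 then W (Z \<omega>) else 0) \<partial>P)"
    by (subst nn_integral_distr) simp_all
  finally show ?thesis .
qed

text \<open>The history up to time \<open>n\<close> is a function of the first \<open>n\<close>
  increments, hence independent of the next one, and the previous lemma applies to it.\<close>

lemma nn_integral_below_step:
  fixes W :: "real \<Rightarrow> ennreal"
  assumes iid: "iid_sequence P X F"
    and W [measurable]: "W \<in> borel_measurable borel"
    and step: "\<And>y. y \<le> 0 \<Longrightarrow> (\<integral>\<^sup>+x. W (y + x) \<partial>F) \<le> W y"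
    and b: "0 \<le> b"
  shows "(\<integral>\<^sup>+\<omega>. W (walk X (Suc n) \<omega> - b) * indicator (below P X b n) \<omega> \<partial>P)
    \<le> (\<integral>\<^sup>+\<omega>. W (walk X n \<omega> - b) * indicator (below P X b n) \<omega> \<partial>P)"
proof -
  interpret prob_space P by (rule iid_sequenceD[OF iid])
  \<comment> \<open>Both the event \<open>below P X b n\<close> and the position relative to the
    barrier are packed into one real variable: the positive default 1 marks a barrier already
    crossed. \<open>g\<close> expresses it through the increments, \<open>Z\<close> through the
    walk.\<close>
  define g where "g v = (if \<forall>i\<in>{1..n}. (\<Sum>j=1..i. v j) \<le> b then (\<Sum>j=1..n. v j) - b else 1)"
    for v :: "nat \<Rightarrow> real"
  define Z where "Z \<omega> = (if \<omega> \<in> below P X b n then walk X n \<omega> - b else 1)" for \<omega>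
  have g: "g \<in> borel_measurable (PiM {1..n} (\<lambda>_. borel))"
  proof -
    have [measurable]: "(\<lambda>v. \<Sum>j=1..i. v j) \<in> borel_measurable (PiM {1..n} (\<lambda>_. borel :: real measure))"
      if "i \<le> n" for i
      using that by (intro borel_measurable_sum measurable_component_singleton) auto
    show ?thesis unfolding g_def by measurable
  qed
  let ?G = "g \<circ> (\<lambda>\<omega>. restrict (\<lambda>i. X i \<omega>) {1..n})"
  have "indep_var (PiM {1..n} (\<lambda>_. borel)) (\<lambda>\<omega>. restrict (\<lambda>i. X i \<omega>) {1..n})
      (PiM {Suc n} (\<lambda>_. borel)) (\<lambda>\<omega>. restrict (\<lambda>i. X i \<omega>) {Suc n})"
    by (rule indep_var_restrict[OF iid_sequenceD(2)[OF iid]]) auto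
  from indep_var_compose[OF this g, of "\<lambda>v. v (Suc n)" borel]
  have "indep_var borel (g \<circ> (\<lambda>\<omega>. restrict (\<lambda>i. X i \<omega>) {1..n}))
      borel ((\<lambda>v. v (Suc n)) \<circ> (\<lambda>\<omega>. restrict (\<lambda>i. X i \<omega>) {Suc n}))"
    by (simp add: measurable_component_singleton)
  moreover have "(\<lambda>v. v (Suc n)) \<circ> (\<lambda>\<omega>. restrict (\<lambda>i. X i \<omega>) {Suc n}) = X (Suc n)"
    by auto
  ultimately have ind: "indep_var borel ?G borel (X (Suc n))"
    by simp
  \<comment> \<open>Equality holds only on \<open>space P\<close>, because \<open>below\<close> is
    cut down to that set.\<close>
  have gZ: "?G \<omega> = Z \<omega>" if "\<omega> \<in> space P" for \<omega>
  proof -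
    have "(\<Sum>j=1..i. restrict (\<lambda>i. X i \<omega>) {1..n} j) = walk X i \<omega>" if "i \<le> n" for i
      using that unfolding walk_def by (intro sum.cong) auto
    then show ?thesis
      using \<open>\<omega> \<in> space P\<close> by (auto simp: g_def Z_def below_def)
  qed
  \<comment> \<open>For \<open>n = 0\<close> the event gives no information; there
    \<open>0 \<le> b\<close> is what keeps the start below the barrier.\<close>
  have le: "walk X n \<omega> \<le> b" if "\<omega> \<in> below P X b n" for \<omega>
    using that b by (cases "n = 0") (auto simp: below_def walk_def)
  have "(\<integral>\<^sup>+\<omega>. W (walk X (Suc n) \<omega> - b) * indicator (below P X b n) \<omega> \<partial>P)
      = (\<integral>\<^sup>+\<omega>. (if Z \<omega> \<le> 0 then W (Z \<omega> + X (Suc n) \<omega>) else 0) \<partial>P)"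
    using le by (intro nn_integral_cong) (auto simp: Z_def walk_def algebra_simps)
  also have "\<dots> \<le> (\<integral>\<^sup>+\<omega>. (if Z \<omega> \<le> 0 then W (Z \<omega>) else 0) \<partial>P)"
  proof -
    have "(\<integral>\<^sup>+\<omega>. (if ?G \<omega> \<le> 0 then W (?G \<omega> + X (Suc n) \<omega>) else 0) \<partial>P)
        \<le> (\<integral>\<^sup>+\<omega>. (if ?G \<omega> \<le> 0 then W (?G \<omega>) else 0) \<partial>P)"
      using step by (intro nn_integral_indep_step[OF prob_space_axioms ind W])
        (simp add: iid_sequenceD(3)[OF iid])
    moreover have "(\<integral>\<^sup>+\<omega>. (if ?G \<omega> \<le> 0 then W (?G \<omega> + X (Suc n) \<omega>) else 0) \<partial>P)
        = (\<integral>\<^sup>+\<omega>. (if Z \<omega> \<le> 0 then W (Z \<omega> + X (Suc n) \<omega>) else 0) \<partial>P)"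
      by (rule nn_integral_cong) (simp only: gZ)
    moreover have "(\<integral>\<^sup>+\<omega>. (if ?G \<omega> \<le> 0 then W (?G \<omega>) else 0) \<partial>P)
        = (\<integral>\<^sup>+\<omega>. (if Z \<omega> \<le> 0 then W (Z \<omega>) else 0) \<partial>P)"
      by (rule nn_integral_cong) (simp only: gZ)
    ultimately show ?thesis by simp
  qed
  also have "\<dots> = (\<integral>\<^sup>+\<omega>. W (walk X n \<omega> - b) * indicator (below P X b n) \<omega> \<partial>P)"
    by (intro nn_integral_cong) (auto simp: Z_def le)
  finally show ?thesis .
qed

text \<open>This is optional stopping for a nonnegative supermartingale, carried out by hand: the
  mass is split according to the time of crossing, and the mass that has not crossed is discarded at
  the end. Almost sure passage excludes the infinite value of the overshoot.\<close>

lemma overshoot_moment_le: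
  fixes W :: "real \<Rightarrow> ennreal"
  assumes iid: "iid_sequence P X F"
    and W [measurable]: "W \<in> borel_measurable borel"
    and step: "\<And>y. y \<le> 0 \<Longrightarrow> (\<integral>\<^sup>+x. W (y + x) \<partial>F) \<le> W y"
    and pow: "\<And>y. 0 < y \<Longrightarrow> ennreal (y ^ k) \<le> W y"
    and b: "0 \<le> b"
    and fin: "AE \<omega> in P. passage_time X b \<omega> \<noteq> \<infinity>"
  shows "(\<integral>\<^sup>+\<omega>. overshoot X b \<omega> ^ k \<partial>P) \<le> W (- b)"
proof -
  interpret prob_space P by (rule iid_sequenceD[OF iid])
  note [measurable] = walk_measurable[OF iid] below_sets[OF iid]
  let ?A = "below P X b"
  \<comment> \<open>\<open>f n\<close> is the contribution of the paths that cross at time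
    \<open>n + 1\<close>.\<close>
  define f where "f n \<omega> = W (walk X (Suc n) \<omega> - b) * indicator (?A n - ?A (Suc n)) \<omega>" for n \<omega>
  have [measurable]: "f n \<in> borel_measurable P" for n
    unfolding f_def by measurable
  have ineq: "(\<integral>\<^sup>+\<omega>. W (walk X n \<omega> - b) * indicator (?A n) \<omega> \<partial>P) + (\<Sum>m<n. \<integral>\<^sup>+\<omega>. f m \<omega> \<partial>P) \<le> W (- b)" for n
  proof (induction n)
    case 0
    have "(\<integral>\<^sup>+\<omega>. W (walk X 0 \<omega> - b) * indicator (?A 0) \<omega> \<partial>P) = (\<integral>\<^sup>+\<omega>. W (- b) \<partial>P)"
      by (intro nn_integral_cong) (auto simp: walk_def below_def)
    then show ?case by (simp add: emeasure_space_1)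
  next
    case (Suc n)
    \<comment> \<open>\<open>?A n\<close> is the disjoint union of \<open>?A (Suc n)\<close> and the
      event of crossing at time \<open>Suc n\<close>.\<close>
    have "(\<integral>\<^sup>+\<omega>. W (walk X (Suc n) \<omega> - b) * indicator (?A (Suc n)) \<omega> \<partial>P) + (\<integral>\<^sup>+\<omega>. f n \<omega> \<partial>P)
      = (\<integral>\<^sup>+\<omega>. W (walk X (Suc n) \<omega> - b) * indicator (?A n) \<omega> \<partial>P)"
      by (subst nn_integral_add[symmetric], measurable)
        (intro nn_integral_cong, auto simp: f_def below_Suc split: split_indicator)
    also have "\<dots> \<le> (\<integral>\<^sup>+\<omega>. W (walk X n \<omega> - b) * indicator (?A n) \<omega> \<partial>P)"
      by (rule nn_integral_below_step[OF iid W step b])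
    finally have "(\<integral>\<^sup>+\<omega>. W (walk X (Suc n) \<omega> - b) * indicator (?A (Suc n)) \<omega> \<partial>P)
        + (\<integral>\<^sup>+\<omega>. f n \<omega> \<partial>P) + (\<Sum>m<n. \<integral>\<^sup>+\<omega>. f m \<omega> \<partial>P) \<le> W (- b)"
      using Suc by (rule order_trans[OF add_right_mono])
    then show ?case by (simp only: sum.lessThan_Suc ac_simps)
  qed
  have "(\<integral>\<^sup>+\<omega>. overshoot X b \<omega> ^ k \<partial>P) \<le> (\<integral>\<^sup>+\<omega>. (\<Sum>n. f n \<omega>) \<partial>P)"
  proof (rule nn_integral_mono_AE)
    \<comment> \<open>The single summand that belongs to the crossing time already dominates the
      overshoot power.\<close>
    show "AE \<omega> in P. overshoot X b \<omega> ^ k \<le> (\<Sum>n. f n \<omega>)"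
      using fin AE_space
    proof eventually_elim
      case \<omega>: (elim \<omega>)
      then obtain N where N: "passage_time X b \<omega> = enat N" by auto
      note N' = passage_time_enatD[OF N]
      then obtain m where m: "N = Suc m" by (cases N) auto
      have "overshoot X b \<omega> ^ k = ennreal ((walk X N \<omega> - b) ^ k)"
        using N N'(2) by (simp add: overshoot_def ennreal_power)
      also have "\<dots> \<le> W (walk X N \<omega> - b)"
        using N'(2) by (intro pow) simp
      also have "\<dots> = f m \<omega>"
        using N' \<omega>(2) by (simp add: f_def m below_def indicator_def) force
      also have "\<dots> \<le> (\<Sum>n. f n \<omega>)"
        using sum_le_suminf[of "\<lambda>n. f n \<omega>" "{m}"] by simp
      finally show ?case .
    qed
  qed
  also have "\<dots> = (\<Sum>n. \<integral>\<^sup>+\<omega>. f n \<omega> \<partial>P)"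
    by (rule nn_integral_suminf) simp
  also have "\<dots> \<le> W (- b)"
  proof (rule suminf_le_const)
    fix n
    show "(\<Sum>m<n. \<integral>\<^sup>+\<omega>. f m \<omega> \<partial>P) \<le> W (- b)"
      by (rule order_trans[OF _ ineq[of n]]) simp
  qed simp
  finally show ?thesis .
qed

text \<open>Being below \<open>b\<close> at time \<open>n\<close> forces
  \<open>exp (s * b) * exp (- s * walk X n \<omega>)\<close> to be at least 1, and the expectation
  of this quantity factorises into \<open>exp (s * b)\<close> times the \<open>n\<close>-th power of
  a number below 1.\<close>

lemma passage_time_finite_AE:
  assumes iid: "iid_sequence P X F" and s: "0 \<le> s"
    and lt1: "(\<integral>\<^sup>+x. ennreal (exp (- s * x)) \<partial>F) < 1"
  shows "AE \<omega> in P. passage_time X b \<omega> \<noteq> \<infinity>"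
proof -
  interpret prob_space P by (rule iid_sequenceD[OF iid])
  note [measurable] = walk_measurable[OF iid] below_sets[OF iid]
  define q where "q = (\<integral>\<^sup>+x. ennreal (exp (- s * x)) \<partial>F)"
  obtain r where r: "q = ennreal r" "0 \<le> r" "r < 1"
    using lt1 unfolding q_def[symmetric] by (cases q) (auto simp: ennreal_less_one_iff)
  \<comment> \<open>The case \<open>n = 0\<close> is left out: \<open>below P X b 0\<close> is the
    whole space, while \<open>b\<close> may be negative here.\<close>
  have bound: "emeasure P (below P X b n) \<le> ennreal (exp (s * b) * r ^ n)" if "1 \<le> n" for n
  proof -
    have ind: "indep_vars (\<lambda>_. borel) (\<lambda>i \<omega>. ennreal (exp (- s * X i \<omega>))) {1..n}"
      by (rule indep_vars_compose2[OF indep_vars_subset[OF iid_sequenceD(2)[OF iid]], where Y = "\<lambda>_ x. ennreal (exp (- s * x))"]) auto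
    have X: "(\<integral>\<^sup>+\<omega>. ennreal (exp (- s * X i \<omega>)) \<partial>P) = q" if "1 \<le> i" for i
      unfolding q_def iid_sequenceD(3)[OF iid that, symmetric]
      using iid_sequenceD(4)[OF iid that] by (subst nn_integral_distr) auto
    have "emeasure P (below P X b n) = (\<integral>\<^sup>+\<omega>. indicator (below P X b n) \<omega> \<partial>P)"
      by simp
    also have "\<dots> \<le> (\<integral>\<^sup>+\<omega>. ennreal (exp (s * b)) * (\<Prod>i=1..n. ennreal (exp (- s * X i \<omega>))) \<partial>P)"
    proof (intro nn_integral_mono)
      fix \<omega>
      have "1 \<le> exp (s * b) * (\<Prod>i=1..n. exp (- s * X i \<omega>))" if "\<omega> \<in> below P X b n"
      proof -
        have "walk X n \<omega> \<le> b" using that \<open>1 \<le> n\<close> by (auto simp: below_def)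
        then have "0 \<le> s * b + (\<Sum>i=1..n. - s * X i \<omega>)"
          using s by (simp add: sum_distrib_left[symmetric] sum_negf walk_def mult_left_mono)
        then show ?thesis
          by (simp add: exp_sum[symmetric] exp_add[symmetric])
      qed
      then show "indicator (below P X b n) \<omega> \<le> ennreal (exp (s * b)) * (\<Prod>i=1..n. ennreal (exp (- s * X i \<omega>)))"
        by (auto simp: prod_ennreal ennreal_mult[symmetric] prod_nonneg simp flip: ennreal_1 split: split_indicator)
    qed
    also have "\<dots> = ennreal (exp (s * b)) * q ^ n"
      using ind X iid_sequenceD(4)[OF iid]
      by (subst nn_integral_cmult) (auto simp: indep_vars_nn_integral intro!: borel_measurable_prod_ennreal)
    also have "\<dots> = ennreal (exp (s * b) * r ^ n)"
      using r by (simp add: ennreal_power ennreal_mult[symmetric])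
    finally show ?thesis .
  qed
  let ?N = "\<Inter>n. below P X b n"
  have "(\<lambda>n. ennreal (exp (s * b) * r ^ n)) \<longlonglongrightarrow> ennreal (exp (s * b) * 0)"
    using r by (intro tendsto_ennrealI tendsto_mult tendsto_const LIMSEQ_realpow_zero) auto
  then have "emeasure P ?N \<le> ennreal (exp (s * b) * 0)"
  proof (rule tendsto_lowerbound)
    show "\<forall>\<^sub>F n in sequentially. emeasure P ?N \<le> ennreal (exp (s * b) * r ^ n)"
    proof (rule eventually_sequentiallyI[of 1])
      fix n :: nat assume "1 \<le> n"
      have "emeasure P ?N \<le> emeasure P (below P X b n)" by (rule emeasure_mono) auto
      also have "\<dots> \<le> ennreal (exp (s * b) * r ^ n)" by (rule bound) fact
      finally show "emeasure P ?N \<le> ennreal (exp (s * b) * r ^ n)" .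
    qed
  qed simp
  then have "?N \<in> null_sets P"
    by (intro null_setsI) auto
  then show ?thesis
    by (rule AE_I') (auto simp: passage_time_eq_infinity_iff below_def)
qed

section \<open>Elementary estimates for exponentials and tails\<close>

text \<open>Raise \<open>u \<le> exp u\<close> with \<open>u = e * x / m\<close> to the power
  \<open>m\<close>; the constant is \<open>(m / e) ^ m\<close>.\<close>

lemma power_le_exp:
  fixes e :: real
  assumes "0 < e"
  shows "\<exists>c>0. \<forall>x\<ge>0. x ^ m \<le> c * exp (e * x)"
proof (cases "m = 0")
  case True
  then show ?thesis using assms by (intro exI[of _ 1]) simp
next
  case False
  have "x ^ m \<le> (m / e) ^ m * exp (e * x)" if x: "0 \<le> x" for x
  proof -
    have "e * x / m \<le> exp (e * x / m)"
      using exp_ge_add_one_self[of "e * x / m"] by linarith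
    then have "(e * x / m) ^ m \<le> exp (e * x / m) ^ m"
      using x assms by (intro power_mono) auto
    also have "\<dots> = exp (e * x)"
      using False by (simp add: exp_of_nat_mult[symmetric])
    finally have "(m / e) ^ m * (e * x / m) ^ m \<le> (m / e) ^ m * exp (e * x)"
      using assms by (intro mult_left_mono) auto
    moreover have "(m / e) ^ m * (e * x / m) ^ m = x ^ m"
      using assms False by (simp add: power_mult_distrib[symmetric])
    ultimately show ?thesis by simp
  qed
  moreover have "0 < (m / e) ^ m" using False assms by simp
  ultimately show ?thesis by blast
qed

lemma (in real_distribution) integrable_tail_le:
  fixes f :: "real \<Rightarrow> real"
  assumes "integrable M f" "0 < d"
  obtains a where "0 \<le> a" "(\<integral>x. f x * indicator {a<..} x \<partial>M) \<le> d"
proof -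
  have [measurable]: "f \<in> borel_measurable M" using assms by auto
  have "(\<lambda>n. \<integral>x. f x * indicator {real n<..} x \<partial>M) \<longlonglongrightarrow> (\<integral>x. 0 \<partial>M)"
  proof (rule integral_dominated_convergence[where w = "\<lambda>x. \<bar>f x\<bar>"])
    show "AE x in M. (\<lambda>n. f x * indicator {real n<..} x) \<longlonglongrightarrow> 0"
    proof (intro AE_I2 tendsto_eventually)
      fix x :: real
      obtain N :: nat where "x \<le> real N" using real_arch_simple by blast
      then show "\<forall>\<^sub>F n in sequentially. f x * indicator {real n<..} x = 0"
        by (intro eventually_sequentiallyI[of N]) (auto split: split_indicator)
    qed
    show "AE x in M. norm (f x * indicator {real n<..} x) \<le> \<bar>f x\<bar>" for n
      by (intro AE_I2) (simp split: split_indicator)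
    show "integrable M (\<lambda>x. \<bar>f x\<bar>)" by (rule integrable_abs[OF assms(1)])
  qed measurable
  then have "(\<lambda>n. \<integral>x. f x * indicator {real n<..} x \<partial>M) \<longlonglongrightarrow> 0" by simp
  then have "\<forall>\<^sub>F n in sequentially. (\<integral>x. f x * indicator {real n<..} x \<partial>M) < d"
    using assms(2) by (rule order_tendstoD)
  then obtain n where "(\<integral>x. f x * indicator {real n<..} x \<partial>M) < d"
    by (auto simp: eventually_sequentially)
  then show ?thesis by (intro that[of "real n"]) simp_all
qed

lemma mult_exp_minus_one_nonneg: "0 \<le> x * (exp (\<theta> * x) - 1)" if "0 \<le> \<theta>" for x \<theta> :: real
  using that by (cases "0 \<le> x") (auto intro!: mult_nonneg_nonneg mult_nonpos_nonpos simp: mult_nonneg_nonpos)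

text \<open>With \<open>u = \<theta> * x\<close>, the bound \<open>exp u - 1 \<le> u * exp u\<close>
  serves for \<open>0 \<le> x\<close>, and \<open>u \<le> exp u - 1\<close>, multiplied by a
  negative \<open>x\<close>, for the rest. Integrated, it shows that the tilted mean is at most of
  order \<theta>.\<close>

lemma mult_exp_minus_one_le:
  fixes x \<theta> :: real
  assumes "0 \<le> \<theta>"
  shows "x * (exp (\<theta> * x) - 1) \<le> \<theta> * (x\<^sup>2 + (max x 0)\<^sup>2 * exp (\<theta> * x))"
proof (cases "0 \<le> x")
  case True
  have "1 - exp (- (\<theta> * x)) \<le> \<theta> * x"
    using exp_ge_add_one_self[of "- (\<theta> * x)"] by linarith
  then have "exp (\<theta> * x) * (1 - exp (- (\<theta> * x))) \<le> exp (\<theta> * x) * (\<theta> * x)"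
    by (rule mult_left_mono) simp
  then have "exp (\<theta> * x) - 1 \<le> exp (\<theta> * x) * (\<theta> * x)"
    by (simp add: algebra_simps exp_minus)
  then have "x * (exp (\<theta> * x) - 1) \<le> x * (exp (\<theta> * x) * (\<theta> * x))"
    using True by (rule mult_left_mono)
  also have "\<dots> \<le> \<theta> * (x\<^sup>2 + x\<^sup>2 * exp (\<theta> * x))"
    using assms by (simp add: algebra_simps power2_eq_square)
  finally show ?thesis using True by simp
next
  case False
  have "x * (exp (\<theta> * x) - 1) \<le> x * (\<theta> * x)"
    using exp_ge_add_one_self[of "\<theta> * x"] False by (intro mult_left_mono_neg) linarith+
  then show ?thesis using False by (simp add: power2_eq_square algebra_simps)
qed

lemma param_space_downward:
  assumes "\<theta> \<in> param_space m" "0 \<le> s" "s \<le> \<theta>"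
  shows "s \<in> param_space m"
proof -
  have "ereal s \<le> ereal \<theta>" using assms(3) by simp
  also have "\<dots> < m" using assms(1) by (simp add: param_space_def)
  finally show ?thesis using assms(2) by (simp add: param_space_def)
qed

text \<open>
  With \<open>y\<close> the position of the walk relative to the barrier, \<open>C - K * exp (e * y)\<close> is superharmonic by
  a margin proportional to \<open>exp (e * y)\<close>. The correction above level \<open>a\<close> makes the function dominate
  \<open>y ^ k\<close> there; a jump from \<open>y \<le> 0\<close> to above \<open>a\<close> exceeds \<open>a\<close>, so for large \<open>a\<close> the correction
  costs less than the margin.
\<close>

definition lyapunov :: "real \<Rightarrow> real \<Rightarrow> real \<Rightarrow> real \<Rightarrow> real \<Rightarrow> real" where
  "lyapunov e a K C y = C - K * exp (e * y) + 2 * K * exp (e * y) * indicator {a<..} y"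

text \<open>Up to level \<open>a\<close> the subtracted term is at most
  \<open>K * exp (e * a)\<close>; above it the correction flips the sign of that term.\<close>

lemma lyapunov_nonneg:
  assumes "0 < e" "0 < K" "K * exp (e * a) \<le> C"
  shows "0 \<le> lyapunov e a K C y"
proof (cases "y \<le> a")
  case True
  then have "K * exp (e * y) \<le> K * exp (e * a)"
    using assms by (intro mult_left_mono) auto
  then have "K * exp (e * y) \<le> C" using assms(3) by (rule order_trans)
  then show ?thesis using True by (simp add: lyapunov_def)
next
  case False
  have "0 \<le> C"
    using assms by (meson exp_ge_zero less_imp_le mult_nonneg_nonneg order_trans)
  then show ?thesis using False assms by (simp add: lyapunov_def)
qed

section \<open>Moments and exponential moments under the tilted laws\<close>

context standard_exponential_family
begin

lemma nonzero: "\<not> (AE x in F0. x = 0)"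
proof
  assume "AE x in F0. x = 0"
  then have "variance (\<lambda>x. x) = (\<integral>x. 0 \<partial>F0)"
    unfolding mean_zero by (intro integral_cong_AE) auto
  then show False using variance_one by simp
qed

lemma expectation_pos:
  fixes f :: "real \<Rightarrow> real"
  assumes "integrable F0 f" "\<And>x. 0 \<le> f x" "\<And>x. f x = 0 \<Longrightarrow> x = 0"
  shows "0 < expectation f"
proof -
  have "expectation f \<noteq> 0"
  proof
    assume "expectation f = 0"
    then have "AE x in F0. f x = 0"
      using integral_nonneg_eq_0_iff_AE[OF assms(1)] assms(2) by simp
    then have "AE x in F0. x = 0" by eventually_elim (rule assms(3))
    then show False using nonzero by contradiction
  qed
  then show ?thesis
    using assms by (simp add: order_less_le integral_nonneg_AE)
qed

text \<open>Strict Jensen inequality: the mean is 0, and \<open>exp u - 1 - u\<close> vanishes only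
  at \<open>u = 0\<close>.\<close>

lemma expectation_exp_gt_one:
  assumes "\<theta> \<in> param_space \<theta>max" "0 < \<theta>"
  shows "1 < expectation (\<lambda>x. exp (\<theta> * x))"
proof -
  note i = exp_integrable[OF assms(1)]
  have "0 < expectation (\<lambda>x. exp (\<theta> * x) - 1 - \<theta> * x)"
  proof (rule expectation_pos)
    fix x :: real
    show "0 \<le> exp (\<theta> * x) - 1 - \<theta> * x"
      using exp_ge_add_one_self[of "\<theta> * x"] by linarith
    show "x = 0" if "exp (\<theta> * x) - 1 - \<theta> * x = 0"
      using that ln_eq_minus_one[of "exp (\<theta> * x)"] assms(2) by simp
  qed (use i mean_integrable in auto)
  then show ?thesis
    using i mean_integrable mean_zero prob_space by simp
qed

lemma exp_cumulant:
  assumes "\<theta> \<in> param_space \<theta>max" "0 < \<theta>"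
  shows "exp (cumulant F0 \<theta>) = expectation (\<lambda>x. exp (\<theta> * x))"
  using expectation_exp_gt_one[OF assms] by (simp add: cumulant_def)

lemma integral_tilted:
  fixes f :: "real \<Rightarrow> real"
  assumes "f \<in> borel_measurable borel"
  shows "integral\<^sup>L (tilted F0 \<theta>) f = expectation (\<lambda>x. f x * exp (\<theta> * x)) / exp (cumulant F0 \<theta>)"
proof -
  have "integral\<^sup>L (tilted F0 \<theta>) f = expectation (\<lambda>x. exp (\<theta> * x - cumulant F0 \<theta>) *\<^sub>R f x)"
    unfolding tilted_def using assms by (intro integral_density) auto
  also have "\<dots> = expectation (\<lambda>x. f x * exp (\<theta> * x) / exp (cumulant F0 \<theta>))"
    by (intro Bochner_Integration.integral_cong) (auto simp: exp_diff)
  finally show ?thesis by simp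
qed

lemma nn_integral_tilted:
  assumes "f \<in> borel_measurable borel"
  shows "(\<integral>\<^sup>+x. f x \<partial>tilted F0 \<theta>) = (\<integral>\<^sup>+x. ennreal (exp (\<theta> * x - cumulant F0 \<theta>)) * f x \<partial>F0)"
  unfolding tilted_def using assms by (intro nn_integral_density) auto

text \<open>The exponent cancels the tilt and leaves \<open>exp (- cumulant F0 \<theta>)\<close>,
  where the cumulant is positive.\<close>

lemma nn_integral_tilted_exp_lt_one:
  assumes "\<theta> \<in> param_space \<theta>max" "0 < \<theta>"
  shows "(\<integral>\<^sup>+x. ennreal (exp (- \<theta> * x)) \<partial>tilted F0 \<theta>) < 1"
proof -
  have "(\<integral>\<^sup>+x. ennreal (exp (- \<theta> * x)) \<partial>tilted F0 \<theta>) = (\<integral>\<^sup>+x. ennreal (exp (- cumulant F0 \<theta>)) \<partial>F0)"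
    by (subst nn_integral_tilted)
      (auto intro!: nn_integral_cong simp: ennreal_mult[symmetric] exp_add[symmetric])
  also have "\<dots> = ennreal (exp (- cumulant F0 \<theta>))"
    using emeasure_space_1 by simp
  also have "\<dots> < 1"
    using expectation_exp_gt_one[OF assms] by (simp add: ennreal_less_one_iff cumulant_def)
  finally show ?thesis .
qed

text \<open>The spare exponent \<open>\<theta> - s\<close> absorbs the polynomial factor.\<close>

lemma integrable_max_power_exp:
  assumes "\<theta> \<in> param_space \<theta>max" "0 \<le> s" "s < \<theta>"
  shows "integrable F0 (\<lambda>x. (max x 0) ^ Suc m * exp (s * x))"
proof -
  obtain c where c: "0 < c" "\<And>x. 0 \<le> x \<Longrightarrow> x ^ Suc m \<le> c * exp ((\<theta> - s) * x)"
    using power_le_exp[of "\<theta> - s" "Suc m"] assms by auto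
  show ?thesis
  proof (rule Bochner_Integration.integrable_bound)
    show "integrable F0 (\<lambda>x. c * exp (\<theta> * x))"
      using exp_integrable[OF assms(1)] by simp
    show "AE x in F0. norm ((max x 0) ^ Suc m * exp (s * x)) \<le> norm (c * exp (\<theta> * x))"
    proof (intro AE_I2)
      fix x
      show "norm ((max x 0) ^ Suc m * exp (s * x)) \<le> norm (c * exp (\<theta> * x))"
      proof (cases "0 \<le> x")
        case True
        have "x ^ Suc m * exp (s * x) \<le> c * exp ((\<theta> - s) * x) * exp (s * x)"
          by (intro mult_right_mono c True) simp
        also have "\<dots> = c * exp (\<theta> * x)"
          by (simp add: exp_add[symmetric] algebra_simps)
        finally show ?thesis using True c by (simp add: abs_mult)
      qed (use c in auto)
    qed
  qed simp
qed

lemma integrable_mult_exp: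
  assumes "\<theta> \<in> param_space \<theta>max" "0 \<le> s" "s < \<theta>"
  shows "integrable F0 (\<lambda>x. x * exp (s * x))"
proof (rule Bochner_Integration.integrable_bound)
  show "integrable F0 (\<lambda>x. (max x 0) ^ Suc 0 * exp (s * x) + \<bar>x\<bar>)"
    using integrable_max_power_exp[OF assms, of 0] mean_integrable
    by (intro Bochner_Integration.integrable_add) simp_all
  show "AE x in F0. norm (x * exp (s * x)) \<le> norm ((max x 0) ^ Suc 0 * exp (s * x) + \<bar>x\<bar>)"
  proof (intro AE_I2)
    fix x
    have "\<bar>x\<bar> * exp (s * x) \<le> \<bar>x\<bar> * 1" if "x < 0"
      using that assms(2) by (intro mult_left_mono) (auto simp: mult_nonneg_nonpos)
    then show "norm (x * exp (s * x)) \<le> norm ((max x 0) ^ Suc 0 * exp (s * x) + \<bar>x\<bar>)"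
      by (cases "x < 0") (auto simp: abs_mult)
  qed
qed simp

text \<open>The expectation here is the tilted mean before normalisation. Since \<open>F0\<close>
  has mean 0, \<open>exp (s * x)\<close> may be replaced by \<open>exp (s * x) - 1\<close>, which
  has the sign of \<open>x\<close> and is of order \<open>s\<close>. The constant \<open>D\<close>
  is the same for all admissible \<open>s\<close>.\<close>

lemma mean_tilted_bounds:
  assumes "\<theta> \<in> param_space \<theta>max" "0 < s" "s \<le> \<theta> / 2"
  defines "D \<equiv> expectation (\<lambda>x. x\<^sup>2 + (max x 0)\<^sup>2 * exp (\<theta> / 2 * x))"
  shows "0 < expectation (\<lambda>x. x * exp (s * x))"
    and "expectation (\<lambda>x. x * exp (s * x)) \<le> s * D"
proof -
  have i: "integrable F0 (\<lambda>x. x * exp (s * x))"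
    using assms by (intro integrable_mult_exp) auto
  then have i': "integrable F0 (\<lambda>x. x * (exp (s * x) - 1))"
    using mean_integrable by (simp add: algebra_simps)
  have eq: "expectation (\<lambda>x. x * exp (s * x)) = expectation (\<lambda>x. x * (exp (s * x) - 1))"
    using i mean_integrable mean_zero by (simp add: algebra_simps)
  have "0 < expectation (\<lambda>x. x * (exp (s * x) - 1))"
    using assms by (intro expectation_pos i' mult_exp_minus_one_nonneg) auto
  then show "0 < expectation (\<lambda>x. x * exp (s * x))" unfolding eq .
  have "expectation (\<lambda>x. x * (exp (s * x) - 1))
      \<le> expectation (\<lambda>x. s * (x\<^sup>2 + (max x 0)\<^sup>2 * exp (\<theta> / 2 * x)))"
  proof (rule integral_mono[OF i'])
    show "integrable F0 (\<lambda>x. s * (x\<^sup>2 + (max x 0)\<^sup>2 * exp (\<theta> / 2 * x)))"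
      using integrable_max_power_exp[OF assms(1), of "\<theta> / 2" 1] assms square_integrable
      by (intro integrable_mult_right Bochner_Integration.integrable_add) (simp_all add: numeral_2_eq_2)
    fix x
    have "(max x 0)\<^sup>2 * exp (s * x) \<le> (max x 0)\<^sup>2 * exp (\<theta> / 2 * x)"
    proof (cases "0 \<le> x")
      case True
      then have "s * x \<le> \<theta> / 2 * x" using assms by (intro mult_right_mono) auto
      then show ?thesis by (intro mult_left_mono) auto
    qed auto
    then have "s * (x\<^sup>2 + (max x 0)\<^sup>2 * exp (s * x)) \<le> s * (x\<^sup>2 + (max x 0)\<^sup>2 * exp (\<theta> / 2 * x))"
      using assms by (intro mult_left_mono) auto
    then show "x * (exp (s * x) - 1) \<le> s * (x\<^sup>2 + (max x 0)\<^sup>2 * exp (\<theta> / 2 * x))"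
      using mult_exp_minus_one_le[of s x] assms by linarith
  qed
  then show "expectation (\<lambda>x. x * exp (s * x)) \<le> s * D"
    unfolding eq D_def by simp
qed

text \<open>Otherwise the law would live on the nonpositive reals with mean 0, hence be concentrated
  at 0.\<close>

lemma expectation_max_power_pos:
  assumes "\<theta> \<in> param_space \<theta>max" "0 < \<theta>"
  shows "0 < expectation (\<lambda>x. (max x 0) ^ Suc k)"
proof -
  have i: "integrable F0 (\<lambda>x. (max x 0) ^ Suc k)"
    using integrable_max_power_exp[OF assms(1), of 0 k] assms by simp
  have "expectation (\<lambda>x. (max x 0) ^ Suc k) \<noteq> 0"
  proof
    assume "expectation (\<lambda>x. (max x 0) ^ Suc k) = 0"
    then have "AE x in F0. (max x 0) ^ Suc k = 0"
      using integral_nonneg_eq_0_iff_AE[OF i] by simp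
    then have nonpos: "AE x in F0. x \<le> 0"
      by eventually_elim (auto simp: max_def split: if_splits)
    then have "AE x in F0. - x = 0"
      using integral_nonneg_eq_0_iff_AE[of F0 "\<lambda>x. - x"] mean_integrable mean_zero by simp
    then show False using nonzero by simp
  qed
  moreover have "0 \<le> expectation (\<lambda>x. (max x 0) ^ Suc k)"
    by (intro integral_nonneg_AE AE_I2) simp
  ultimately show ?thesis by linarith
qed

text \<open>The factors \<open>exp (e * x) - 1\<close> and \<open>exp (s * x) - 1\<close> have the
  same sign, so their product is nonnegative. The lower bound obtained for the superharmonic margin
  does not depend on \<open>s\<close>.\<close>

lemma expectation_exp_add:
  assumes "\<theta> \<in> param_space \<theta>max" "0 \<le> s" "0 \<le> e" "e + s \<le> \<theta>"
  shows "expectation (\<lambda>x. exp (e * x)) - 1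
    \<le> expectation (\<lambda>x. exp ((e + s) * x)) - expectation (\<lambda>x. exp (s * x))"
proof -
  have i: "integrable F0 (\<lambda>x. exp ((e + s) * x))" "integrable F0 (\<lambda>x. exp (s * x))"
    "integrable F0 (\<lambda>x. exp (e * x))"
    using assms by (intro exp_integrable param_space_downward[OF assms(1)]; simp)+
  have "0 \<le> expectation (\<lambda>x. exp ((e + s) * x) - exp (s * x) - exp (e * x) + 1)"
  proof (intro integral_nonneg_AE AE_I2)
    fix x :: real
    have "0 \<le> (exp (e * x) - 1) * (exp (s * x) - 1)"
      using assms(2,3) by (cases "0 \<le> x")
        (auto intro!: mult_nonneg_nonneg mult_nonpos_nonpos simp: mult_nonneg_nonpos)
    then show "0 \<le> exp ((e + s) * x) - exp (s * x) - exp (e * x) + 1"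
      by (simp add: algebra_simps exp_add)
  qed
  then show ?thesis using i prob_space by simp
qed

section \<open>Uniform overshoot bounds and comparison with the moment ratio\<close>

text \<open>Up to normalisation by \<open>m\<close>, the exponential term gains
  \<open>K * exp (e * y)\<close> times the difference in \<open>expectation_exp_add\<close>, and the
  correction costs \<open>K * exp (e * y) * (2 * T)\<close>. The choice of \<open>a\<close> in
  \<open>tail\<close> makes the gain cover the cost for every \<open>s\<close> at once.\<close>

lemma lyapunov_superharmonic:
  assumes \<theta>: "\<theta> \<in> param_space \<theta>max" "0 < e" "0 < s" "e + s \<le> \<theta>"
    and a: "0 \<le> a"
    and tail: "expectation (\<lambda>x. exp (\<theta> * x) * indicator {a<..} x)
      \<le> (expectation (\<lambda>x. exp (e * x)) - 1) / 2"
    and K: "0 < K" "K * exp (e * a) \<le> C"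
    and y: "y \<le> 0"
  shows "(\<integral>\<^sup>+x. ennreal (lyapunov e a K C (y + x)) \<partial>tilted F0 s) \<le> ennreal (lyapunov e a K C y)"
proof -
  let ?W = "lyapunov e a K C"
  have s: "s \<in> param_space \<theta>max" "e + s \<in> param_space \<theta>max"
    using \<theta> by (auto intro!: param_space_downward[OF \<theta>(1)])
  have [measurable]: "?W \<in> borel_measurable borel"
    unfolding lyapunov_def by measurable
  define m where "m = expectation (\<lambda>x. exp (s * x))"
  define T where "T = expectation (\<lambda>x. exp ((e + s) * x) * indicator {a<..} (y + x))"
  have m: "0 < m" "exp (cumulant F0 s) = m"
    using expectation_exp_gt_one[OF s(1)] exp_cumulant[OF s(1)] \<theta> by (auto simp: m_def)
  have i1: "integrable F0 (\<lambda>x. exp (s * x))" and i2: "integrable F0 (\<lambda>x. exp ((e + s) * x))"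
    using s by (intro exp_integrable; simp)+
  have i3: "integrable F0 (\<lambda>x. exp ((e + s) * x) * indicator {a<..} (y + x))"
    by (rule Bochner_Integration.integrable_bound[OF i2]) (auto split: split_indicator)
  have expand: "?W (y + x) * exp (s * x)
      = C * exp (s * x) - K * exp (e * y) * exp ((e + s) * x)
        + 2 * K * exp (e * y) * (exp ((e + s) * x) * indicator {a<..} (y + x))" for x
    by (simp add: lyapunov_def algebra_simps exp_add)
  have iW: "integrable F0 (\<lambda>x. ?W (y + x) * exp (s * x))"
    unfolding expand using i1 i2 i3 by simp
  have EW: "expectation (\<lambda>x. ?W (y + x) * exp (s * x))
      = C * m - K * exp (e * y) * expectation (\<lambda>x. exp ((e + s) * x)) + 2 * K * exp (e * y) * T"
    unfolding expand m_def T_def using i1 i2 i3 by simp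
  \<comment> \<open>A jump from \<open>y \<le> 0\<close> to above \<open>a\<close> has
    \<open>x > a \<ge> 0\<close>, so the exponent may be raised to \<theta>; the bound is then free
    of \<open>y\<close> and \<open>s\<close>.\<close>
  have "T \<le> expectation (\<lambda>x. exp (\<theta> * x) * indicator {a<..} x)"
    unfolding T_def
  proof (rule integral_mono[OF i3])
    show "integrable F0 (\<lambda>x. exp (\<theta> * x) * indicator {a<..} x)"
      by (rule Bochner_Integration.integrable_bound[OF exp_integrable[OF \<theta>(1)]])
        (auto split: split_indicator)
    fix x
    show "exp ((e + s) * x) * indicator {a<..} (y + x) \<le> exp (\<theta> * x) * indicat_real {a<..} x"
    proof (cases "a < y + x")
      case True
      then have "a < x" using y by simp
      then have "(e + s) * x \<le> \<theta> * x" using \<theta> a by (intro mult_right_mono) auto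
      then show ?thesis using \<open>a < x\<close> True by simp
    qed simp
  qed
  then have "2 * T \<le> expectation (\<lambda>x. exp ((e + s) * x)) - m"
    using tail expectation_exp_add[OF \<theta>(1), of s e] \<theta> by (simp add: m_def)
  then have "K * exp (e * y) * (2 * T) \<le> K * exp (e * y) * (expectation (\<lambda>x. exp ((e + s) * x)) - m)"
    using K by (intro mult_left_mono) auto
  \<comment> \<open>Since \<open>y \<le> 0 \<le> a\<close>, the correction is absent from
    \<open>?W y\<close>.\<close>
  then have le: "expectation (\<lambda>x. ?W (y + x) * exp (s * x)) \<le> ?W y * m"
    using y a unfolding EW by (simp add: lyapunov_def algebra_simps)
  have "(\<integral>\<^sup>+x. ennreal (?W (y + x)) \<partial>tilted F0 s)
      = (\<integral>\<^sup>+x. ennreal (?W (y + x) * exp (s * x) / m) \<partial>F0)"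
    using lyapunov_nonneg[OF \<theta>(2) K] m
    by (subst nn_integral_tilted)
      (auto intro!: nn_integral_cong simp: ennreal_mult[symmetric] exp_diff mult.commute)
  also have "\<dots> = ennreal (expectation (\<lambda>x. ?W (y + x) * exp (s * x) / m))"
    using iW lyapunov_nonneg[OF \<theta>(2) K] m by (intro nn_integral_eq_integral AE_I2) auto
  also have "\<dots> \<le> ennreal (?W y)"
    using le m by (intro ennreal_leI) (simp add: pos_divide_le_eq)
  finally show ?thesis .
qed

text \<open>The parameters of the Lyapunov function depend on \<theta> and \<open>k\<close> only,
  which makes \<open>C\<close> uniform in the tilt \<open>s\<close> and the barrier
  \<open>b\<close>.\<close>

lemma overshoot_moment_bounded:
  assumes \<theta>: "\<theta> \<in> param_space \<theta>max" "0 < \<theta>"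
  shows "\<exists>C>0. \<forall>(P :: 'a measure) X s b. iid_sequence P X (tilted F0 s) \<longrightarrow>
    0 < s \<longrightarrow> s \<le> \<theta> / 2 \<longrightarrow> 0 \<le> b \<longrightarrow> (\<integral>\<^sup>+\<omega>. overshoot X b \<omega> ^ k \<partial>P) \<le> ennreal C"
proof -
  \<comment> \<open>Half of \<theta> goes to the Lyapunov exponent, the other half is left for the
    tilt, so that \<open>e + s \<le> \<theta>\<close>.\<close>
  define e where "e = \<theta> / 2"
  have e: "0 < e" "e \<in> param_space \<theta>max"
    using \<theta> by (auto simp: e_def intro!: param_space_downward[OF \<theta>(1)])
  obtain a where a: "0 \<le> a" "expectation (\<lambda>x. exp (\<theta> * x) * indicator {a<..} x)
      \<le> (expectation (\<lambda>x. exp (e * x)) - 1) / 2"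
    using integrable_tail_le[OF exp_integrable[OF \<theta>(1)], of "(expectation (\<lambda>x. exp (e * x)) - 1) / 2"]
      expectation_exp_gt_one[OF e(2,1)] by auto
  obtain K where K: "0 < K" "\<And>x. 0 \<le> x \<Longrightarrow> x ^ k \<le> K * exp (e * x)"
    using power_le_exp[OF e(1), of k] by auto
  \<comment> \<open>The first summand keeps the function nonnegative; the second makes it dominate
    \<open>y ^ k\<close> for \<open>0 < y \<le> a\<close>, where the correction is not yet
    active.\<close>
  define C where "C = K * exp (e * a) + a ^ k"
  have C: "0 < C" "K * exp (e * a) \<le> C"
    using K a by (auto simp: C_def intro!: add_pos_nonneg)
  let ?W = "lyapunov e a K C"
  have [measurable]: "?W \<in> borel_measurable borel"
    unfolding lyapunov_def by measurable
  have pow: "y ^ k \<le> ?W y" if "0 < y" for y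
  proof (cases "y \<le> a")
    case True
    then have "K * exp (e * y) \<le> K * exp (e * a)" "y ^ k \<le> a ^ k"
      using K e that by (auto intro!: mult_left_mono power_mono)
    then show ?thesis using True by (simp add: lyapunov_def C_def)
  next
    case False
    then show ?thesis using K(2)[of y] C that by (simp add: lyapunov_def)
  qed
  have "(\<integral>\<^sup>+\<omega>. overshoot X b \<omega> ^ k \<partial>P) \<le> ennreal C"
    if iid: "iid_sequence P X (tilted F0 s)" and s: "0 < s" "s \<le> \<theta> / 2" and b: "0 \<le> b"
    for P :: "'a measure" and X s b
  proof -
    have "s \<in> param_space \<theta>max"
      using s \<theta> by (intro param_space_downward[OF \<theta>(1)]) auto
    then have fin: "AE \<omega> in P. passage_time X b \<omega> \<noteq> \<infinity>"
      using s by (intro passage_time_finite_AE[OF iid, of s] nn_integral_tilted_exp_lt_one) auto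
    have "(\<integral>\<^sup>+\<omega>. overshoot X b \<omega> ^ k \<partial>P) \<le> ennreal (?W (- b))"
    proof (rule overshoot_moment_le[OF iid _ _ _ b fin, where W = "\<lambda>y. ennreal (?W y)"])
      show "(\<integral>\<^sup>+x. ennreal (?W (y + x)) \<partial>tilted F0 s) \<le> ennreal (?W y)" if "y \<le> 0" for y
        using s that by (intro lyapunov_superharmonic[OF \<theta>(1) e(1) _ _ a K(1) C(2)])
          (auto simp: e_def)
    qed (auto intro!: ennreal_leI pow)
    also have "\<dots> \<le> ennreal C"
      using K a b by (intro ennreal_leI) (simp add: lyapunov_def)
    finally show ?thesis .
  qed
  with C(1) show ?thesis by blast
qed

text \<open>As \<open>s\<close> decreases to 0 the denominator is at most of order \<open>s\<close>
  while the numerator stays above \<open>B\<close>, so the ratio eventually exceeds the uniform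
  bound \<open>C\<close>.\<close>

lemma overshoot_moment_le_moment_ratio:
  fixes P :: "real \<Rightarrow> 'a measure"
  assumes \<theta>: "\<theta> \<in> param_space \<theta>max" "0 < \<theta>"
    and iid: "\<And>s. s \<in> param_space \<theta>max \<Longrightarrow> iid_sequence (P s) X (tilted F0 s)"
  shows "\<exists>\<theta>k\<in>{0<..\<theta>}. \<forall>s\<in>{0<..\<theta>k}. \<forall>b\<ge>0.
    (\<integral>\<^sup>+\<omega>. overshoot X b \<omega> ^ k \<partial>P s)
      \<le> ennreal ((\<integral>\<omega>. (max (X 1 \<omega>) 0) ^ (k + 1) \<partial>P s) / (\<integral>\<omega>. X 1 \<omega> \<partial>P s))"
proof -
  obtain C where C: "0 < C" "\<And>s b. \<lbrakk>iid_sequence (P s) X (tilted F0 s); 0 < s; s \<le> \<theta> / 2; 0 \<le> b\<rbrakk>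
      \<Longrightarrow> (\<integral>\<^sup>+\<omega>. overshoot X b \<omega> ^ k \<partial>P s) \<le> ennreal C"
    using overshoot_moment_bounded[OF \<theta>, of k, where 'a = 'a] by blast
  define B where "B = expectation (\<lambda>x. (max x 0) ^ Suc k)"
  define D where "D = expectation (\<lambda>x. x\<^sup>2 + (max x 0)\<^sup>2 * exp (\<theta> / 2 * x))"
  have B: "0 < B" unfolding B_def by (rule expectation_max_power_pos[OF \<theta>])
  have D: "0 \<le> D" unfolding D_def by (intro integral_nonneg_AE AE_I2) simp
  \<comment> \<open>The second bound is chosen so that \<open>C * (s * (D + 1)) \<le> B\<close>;
    \<open>D + 1\<close> instead of \<open>D\<close> keeps the divisor positive.\<close>
  define \<theta>k where "\<theta>k = min (\<theta> / 2) (B / (C * (D + 1)))"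
  have \<theta>k: "0 < \<theta>k" "\<theta>k \<le> \<theta> / 2"
    using \<theta> B C D unfolding \<theta>k_def by (simp, intro min.cobounded1)
  have "(\<integral>\<^sup>+\<omega>. overshoot X b \<omega> ^ k \<partial>P s)
      \<le> ennreal ((\<integral>\<omega>. (max (X 1 \<omega>) 0) ^ (k + 1) \<partial>P s) / (\<integral>\<omega>. X 1 \<omega> \<partial>P s))"
    if s: "0 < s" "s \<le> \<theta>k" and b: "0 \<le> b" for s b
  proof -
    have s_in: "s \<in> param_space \<theta>max"
      using s \<theta>k \<theta> by (intro param_space_downward[OF \<theta>(1)]) auto
    note iid' = iid[OF s_in]
    define \<mu> where "\<mu> = expectation (\<lambda>x. x * exp (s * x))"
    define N where "N = expectation (\<lambda>x. (max x 0) ^ Suc k * exp (s * x))"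
    have \<mu>: "0 < \<mu>" "\<mu> \<le> s * D"
      using mean_tilted_bounds[OF \<theta>(1), of s] s \<theta>k by (auto simp: \<mu>_def D_def)
    \<comment> \<open>The weight \<open>exp (s * x)\<close> is at least 1 wherever the positive part
      is nonzero.\<close>
    have "B \<le> N"
      unfolding B_def N_def
    proof (rule integral_mono)
      show "integrable F0 (\<lambda>x. (max x 0) ^ Suc k)"
        using integrable_max_power_exp[OF \<theta>(1), of 0 k] \<theta> by simp
      show "integrable F0 (\<lambda>x. (max x 0) ^ Suc k * exp (s * x))"
        using s \<theta>k \<theta> by (intro integrable_max_power_exp[OF \<theta>(1)]) auto
      show "(max x 0) ^ Suc k \<le> (max x 0) ^ Suc k * exp (s * x)" for x :: real
      proof (cases "0 \<le> x")
        case True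
        then have "1 \<le> exp (s * x)" using s by simp
        then show ?thesis using True mult_left_mono[of 1 "exp (s * x)" "x ^ Suc k"] by simp
      qed simp
    qed
    moreover have "C * \<mu> \<le> B"
    proof -
      have "C * \<mu> \<le> C * (s * (D + 1))"
        using C \<mu> s D by (intro mult_left_mono) (auto simp: algebra_simps)
      also have "\<dots> = s * (C * (D + 1))" by simp
      also have "\<dots> \<le> B / (C * (D + 1)) * (C * (D + 1))"
        using s C D by (intro mult_right_mono) (auto simp: \<theta>k_def)
      also have "\<dots> = B" using C D by simp
      finally show ?thesis .
    qed
    ultimately have "C \<le> N / \<mu>"
      using \<mu> by (simp add: pos_le_divide_eq)
    \<comment> \<open>The normalising constants of the tilted law cancel in the quotient.\<close>
    also have "N / \<mu> = (\<integral>x. (max x 0) ^ (k + 1) \<partial>tilted F0 s) / (\<integral>x. x \<partial>tilted F0 s)"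
      by (subst (1 2) integral_tilted) (simp_all add: N_def \<mu>_def)
    also have "\<dots> = (\<integral>\<omega>. (max (X 1 \<omega>) 0) ^ (k + 1) \<partial>P s) / (\<integral>\<omega>. X 1 \<omega> \<partial>P s)"
      unfolding iid_sequenceD(3)[OF iid' order_refl, symmetric]
      using iid_sequenceD(4)[OF iid', of 1] by (simp add: integral_distr)
    finally have "C \<le> (\<integral>\<omega>. (max (X 1 \<omega>) 0) ^ (k + 1) \<partial>P s) / (\<integral>\<omega>. X 1 \<omega> \<partial>P s)" .
    then show ?thesis
      using C(2)[OF iid' s(1) _ b] s \<theta>k by (meson ennreal_leI order_trans)
  qed
  then show ?thesis
    using \<theta>k \<theta> by (intro bexI[of _ \<theta>k]) auto
qed

lemma param_space_pos: "\<exists>\<theta>\<in>param_space \<theta>max. 0 < \<theta>"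
proof -
  obtain r where "0 < ereal r" "ereal r < \<theta>max"
    using ereal_dense2[OF \<theta>max_pos] by auto
  then show ?thesis by (intro bexI[of _ r]) (auto simp: param_space_def)
qed

end

theorem corollary2:
  fixes F0 :: "real measure" and \<theta>max :: ereal
    and P :: "real \<Rightarrow> 'a measure" and X :: "nat \<Rightarrow> 'a \<Rightarrow> real"
  assumes "standard_exponential_family F0 \<theta>max"
    and "\<And>\<theta>. \<theta> \<in> param_space \<theta>max \<Longrightarrow> iid_sequence (P \<theta>) X (tilted F0 \<theta>)"
  shows "\<exists>\<theta>star>0. {0..\<theta>star} \<subseteq> param_space \<theta>max \<and>
    (\<forall>k::nat. k \<ge> 1 \<longrightarrow> (\<exists>\<theta>k. \<theta>k \<in> {0<..\<theta>star} \<and>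
      (\<forall>\<theta>. \<theta> \<in> {0<..\<theta>k} \<longrightarrow> (\<forall>b\<ge>0.
        (\<integral>\<^sup>+\<omega>. (overshoot X b \<omega>) ^ k \<partial>P \<theta>)
          \<le> ennreal ((\<integral>\<omega>. (max (X 1 \<omega>) 0) ^ (k + 1) \<partial>P \<theta>) / (\<integral>\<omega>. X 1 \<omega> \<partial>P \<theta>))))))"
proof -
  interpret standard_exponential_family F0 \<theta>max by fact
  \<comment> \<open>Any positive parameter can serve as \<open>\<theta>star\<close>; only
    \<open>\<theta>k\<close> has to be small.\<close>
  obtain \<theta> where \<theta>: "\<theta> \<in> param_space \<theta>max" "0 < \<theta>"
    using param_space_pos by auto
  have "{0..\<theta>} \<subseteq> param_space \<theta>max"
    using param_space_downward[OF \<theta>(1)] by auto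
  moreover have "\<exists>\<theta>k. \<theta>k \<in> {0<..\<theta>} \<and> (\<forall>s. s \<in> {0<..\<theta>k} \<longrightarrow> (\<forall>b\<ge>0.
        (\<integral>\<^sup>+\<omega>. (overshoot X b \<omega>) ^ k \<partial>P s)
          \<le> ennreal ((\<integral>\<omega>. (max (X 1 \<omega>) 0) ^ (k + 1) \<partial>P s) / (\<integral>\<omega>. X 1 \<omega> \<partial>P s))))" for k
    using overshoot_moment_le_moment_ratio[OF \<theta> assms(2), of k] by blast
  ultimately show ?thesis
    using \<theta>(2) by blast
qed

end
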